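(* Let $\underline h=(h^0,h^1,h^0)$ be weight $2$ Hodge numbers, and let $\Diamond_0,\Diamond_1$ be admissible Hodge diamonds of type $\underline h$. For $i=0,1$ write $a_i:=\Diamond_i^{0,0}$ and $b_i:=\Diamond_i^{0,1}$. Then $\Diamond_1\preceq\Diamond_0$ if and only if $$a_1\leq a_0,\qquad a_1+b_1\leq a_0+b_0,\qquad\text{and}\qquad a_0+b_0\leq h^1-b_1.$$
   Context: Admissible Hodge diamonds. For nonnegative integers $\underline h=(h^0,\ldots,h^r)$ with $h^p=h^{r-p}$, an admissible Hodge diamond of type $\underline h$ is a collection of nonnegative integers $\Diamond=\{\Diamond^{p,q}\}_{0\leq p,q\leq r}$ (with $\Diamond^{p,q}:=0$ for other $p,q$) such that $\sum_q\Diamond^{p,q}=h^p$ for all $p$; $\Diamond^{q,p}=\Diamond^{p,q}=\Diamond^{r-q,r-p}=\Diamond^{r-p,r-q}$; and $\Diamond^{p,q}\leq\Diamond^{p+1,q+1}$ for $p+q<r$. For $r=2$, a diamond is determined by $a=\Diamond^{0,0}=\Diamond^{2,2}$ and $b=\Diamond^{0,1}=\Diamond^{1,0}=\Diamond^{1,2}=\Diamond^{2,1}$, since $\Diamond^{0,2}=\Diamond^{2,0}=h^0-a-b$ and $\Diamond^{1,1}=h^1-2b$; it is admissible iff $a,b\geq 0$, $a+2b\leq h^1$ and $a+b\leq h^0$. Polarized relation. For an admissible $\Diamond_1$ of type $\underline h$ put $P_w^{p,w-p}:=\Diamond_1^{p,w-p}-\Diamond_1^{p-1,w-p-1}$ for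 $0\leq w\leq r$ (so $\Diamond_1=\sum_{w=0}^r\sum_{a=0}^{r-w}P_w(-a)$ with $P_w(-a)^{p,q}:=P_w^{p-a,q-a}$). Then $\Diamond_1\preceq\Diamond_0$ means that there exist admissible (weight-$w$) Hodge diamonds $\Diamond_{P_w}$ of type $(P_w^{0,w},P_w^{1,w-1},\ldots,P_w^{w,0})$, $0\leq w\leq r$, with $\Diamond_0=\sum_{w=0}^r\sum_{a=0}^{r-w}\Diamond_{P_w}(-a)$, where $(\Diamond_{P_w}(-a))^{p,q}:=\Diamond_{P_w}^{p-a,q-a}$. *)

theory Defs
  imports Main
begin

text \<open>
  A diamond is a function of two integer indices that vanishes outside the square
  \<open>{0..r} \<times> {0..r}\<close>, so that index shifts need no side conditions; its entries are integers,
  with nonnegativity demanded explicitly, so that differences of entries are genuine differences.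
  Only the values of \<open>h\<close> on \<open>{0..r}\<close> are relevant.
\<close>

definition hodge_numbers :: "int \<Rightarrow> (int \<Rightarrow> int) \<Rightarrow> bool" where
  "hodge_numbers r h \<longleftrightarrow> 0 \<le> r \<and> (\<forall>p\<in>{0..r}. 0 \<le> h p \<and> h p = h (r - p))"

definition admissible_diamond :: "int \<Rightarrow> (int \<Rightarrow> int) \<Rightarrow> (int \<Rightarrow> int \<Rightarrow> int) \<Rightarrow> bool" where
  "admissible_diamond r h D \<longleftrightarrow>
     hodge_numbers r h \<and>
     (\<forall>p q. \<not> (p \<in> {0..r} \<and> q \<in> {0..r}) \<longrightarrow> D p q = 0) \<and>
     (\<forall>p\<in>{0..r}. \<forall>q\<in>{0..r}. 0 \<le> D p q) \<and>
     (\<forall>p\<in>{0..r}. (\<Sum>q = 0..r. D p q) = h p) \<and>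
     (\<forall>p\<in>{0..r}. \<forall>q\<in>{0..r}.
        D q p = D p q \<and> D p q = D (r - q) (r - p) \<and> D (r - q) (r - p) = D (r - p) (r - q)) \<and>
     (\<forall>p\<in>{0..r}. \<forall>q\<in>{0..r}. p + q < r \<longrightarrow> D p q \<le> D (p + 1) (q + 1))"

text \<open>The twist \<open>D(-a)\<close>.\<close>

definition twist :: "int \<Rightarrow> (int \<Rightarrow> int \<Rightarrow> int) \<Rightarrow> int \<Rightarrow> int \<Rightarrow> int" where
  "twist a D p q = D (p - a) (q - a)"

text \<open>The Hodge number \<open>P\<^sub>w\<^sup>p\<^sup>,\<^sup>w\<^sup>-\<^sup>p\<close> of the weight \<open>w\<close> primitive part of \<open>D\<close>.\<close>

definition primitive :: "(int \<Rightarrow> int \<Rightarrow> int) \<Rightarrow> int \<Rightarrow> int \<Rightarrow> int" where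
  "primitive D w p = D p (w - p) - D (p - 1) (w - p - 1)"

definition polarized_le :: "int \<Rightarrow> (int \<Rightarrow> int \<Rightarrow> int) \<Rightarrow> (int \<Rightarrow> int \<Rightarrow> int) \<Rightarrow> bool" where
  "polarized_le r D1 D0 \<longleftrightarrow>
     (\<exists>DP :: int \<Rightarrow> int \<Rightarrow> int \<Rightarrow> int.
        (\<forall>w\<in>{0..r}. admissible_diamond w (primitive D1 w) (DP w)) \<and>
        (\<forall>p q. D0 p q = (\<Sum>w = 0..r. \<Sum>a = 0..r - w. twist a (DP w) p q)))"

end

theory Submission
  imports Defs
begin

text \<open>
  A diamond of weight 1 is determined by its corner, and one of weight 2 by its entries at
  \<open>(0,0)\<close> and \<open>(0,1)\<close>. The primitive parts of \<open>D1\<close> have types \<open>(a1)\<close>, \<open>(b1, b1)\<close> and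
  \<open>(h0 - a1 - b1, h1 - 2 b1 - a1, h0 - a1 - b1)\<close>, so a polarized degeneration amounts to a
  choice of a corner \<open>c\<close> in weight 1 and of parameters \<open>x, y\<close> in weight 2 with
  \<open>a0 = a1 + c + x\<close> and \<open>b0 = b1 - c + y\<close>. Eliminating \<open>x\<close> and \<open>y\<close> leaves lower bounds \<open>0\<close>,
  \<open>b1 - b0\<close> and upper bounds \<open>b1\<close>, \<open>a0 - a1\<close>, \<open>h1 - a0 - 2 b0\<close> for \<open>c\<close>; a suitable \<open>c\<close> exists
  iff each lower bound is at most each upper bound.
\<close>

definition diamond0 :: "int \<Rightarrow> int \<Rightarrow> int \<Rightarrow> int" where
  "diamond0 a p q = (if p = 0 \<and> q = 0 then a else 0)"

text \<open>Here \<open>k\<close> is the common Hodge number and \<open>c\<close> the corner; the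
  row sum forces the off-diagonal entries.\<close>

definition diamond1 :: "int \<Rightarrow> int \<Rightarrow> int \<Rightarrow> int \<Rightarrow> int" where
  "diamond1 k c p q =
     (if p \<in> {0, 1} \<and> q \<in> {0, 1} then if p = q then c else k - c else 0)"

text \<open>The parameters are the entries at \<open>(0,0)\<close> and \<open>(0,1)\<close>. No
  inequalities are built in, so identities between such diamonds hold for arbitrary
  integers.\<close>

definition diamond2 :: "int \<Rightarrow> int \<Rightarrow> int \<Rightarrow> int \<Rightarrow> int \<Rightarrow> int \<Rightarrow> int" where
  "diamond2 h0 h1 a b p q =
     (if p \<in> {0, 2} \<and> q \<in> {0, 2} then if p = q then a else h0 - a - b
      else if p = 1 \<and> q = 1 then h1 - 2 * b
      else if p \<in> {0, 1, 2} \<and> q \<in> {0, 1, 2} then b else 0)"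

lemma diamond_outside:
  "\<not> (p = 0 \<and> q = 0) \<Longrightarrow> diamond0 a p q = 0"
  "\<not> (p \<in> {0, 1} \<and> q \<in> {0, 1}) \<Longrightarrow> diamond1 k c p q = 0"
  "\<not> (p \<in> {0, 1, 2} \<and> q \<in> {0, 1, 2}) \<Longrightarrow> diamond2 h0 h1 a b p q = 0"
  by (auto simp: diamond0_def diamond1_def diamond2_def)

lemma atLeastAtMost_0_1_int: "{0..1::int} = {0, 1}"
  by auto

lemma atLeastAtMost_0_2_int: "{0..2::int} = {0, 1, 2}"
  by auto

lemmas small_intervals = atLeastAtMost_0_1_int atLeastAtMost_0_2_int

lemma hodge_numbers_0_iff: "hodge_numbers 0 h \<longleftrightarrow> 0 \<le> h 0"
  by (auto simp: hodge_numbers_def)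

lemma hodge_numbers_1_iff: "hodge_numbers 1 h \<longleftrightarrow> 0 \<le> h 0 \<and> h 1 = h 0"
  by (auto simp: hodge_numbers_def small_intervals)

lemma hodge_numbers_2_iff:
  "hodge_numbers 2 h \<longleftrightarrow> 0 \<le> h 0 \<and> 0 \<le> h 1 \<and> h 2 = h 0"
  by (auto simp: hodge_numbers_def small_intervals)

lemma admissible_diamondD:
  assumes "admissible_diamond r h D"
  shows "hodge_numbers r h"
    and "\<not> (p \<in> {0..r} \<and> q \<in> {0..r}) \<Longrightarrow> D p q = 0"
    and "p \<in> {0..r} \<Longrightarrow> q \<in> {0..r} \<Longrightarrow> 0 \<le> D p q"
    and "p \<in> {0..r} \<Longrightarrow> (\<Sum>q = 0..r. D p q) = h p"
    and "p \<in> {0..r} \<Longrightarrow> q \<in> {0..r} \<Longrightarrow> D q p = D p q"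
    and "p \<in> {0..r} \<Longrightarrow> q \<in> {0..r} \<Longrightarrow> D (r - q) (r - p) = D p q"
    and "p \<in> {0..r} \<Longrightarrow> q \<in> {0..r} \<Longrightarrow> p + q < r \<Longrightarrow> D p q \<le> D (p + 1) (q + 1)"
  using assms unfolding admissible_diamond_def by metis+

lemma admissible_diamond_0_iff:
  "admissible_diamond 0 h D \<longleftrightarrow> 0 \<le> h 0 \<and> D = diamond0 (h 0)"
  by (auto simp: admissible_diamond_def hodge_numbers_0_iff diamond0_def fun_eq_iff)

text \<open>The symmetries and the sum of row 0 leave only the corner free. The monotonicity
  condition, \<open>D 0 0 \<le> D 1 1\<close>, holds with equality.\<close>

lemma admissible_diamond_1_iff:
  "admissible_diamond 1 h D \<longleftrightarrow>
     h 1 = h 0 \<and> (\<exists>c. 0 \<le> c \<and> c \<le> h 0 \<and> D = diamond1 (h 0) c)"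
  (is "?L \<longleftrightarrow> ?R")
proof
  assume ?L
  note L = admissible_diamondD[OF this]
  have h: "h 1 = h 0"
    using L(1) by (simp add: hodge_numbers_1_iff)
  have D: "D 0 0 + D 0 1 = h 0" "D 1 0 = D 0 1" "D 1 1 = D 0 0" "0 \<le> D 0 0" "0 \<le> D 0 1"
    using L(4)[of 0] L(5)[of 0 1] L(6)[of 0 0] L(3)[of 0 0] L(3)[of 0 1]
    by (simp_all add: small_intervals)
  have "D p q = 0" if "\<not> (p \<in> {0, 1} \<and> q \<in> {0, 1})" for p q
    using L(2) that unfolding small_intervals .
  then have "D p q = diamond1 (h 0) (D 0 0) p q" for p q
  proof (cases "p \<in> {0, 1} \<and> q \<in> {0, 1}")
    case True
    then show ?thesis
      using D by (elim conjE insertE emptyE; hypsubst; simp add: diamond1_def)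
  qed (metis diamond_outside(2))
  then have "D = diamond1 (h 0) (D 0 0)"
    by blast
  moreover from D have "D 0 0 \<le> h 0"
    by linarith
  ultimately show ?R using D(4) h by blast
next
  assume ?R
  then obtain c where h: "h 1 = h 0" and D: "D = diamond1 (h 0) c" and c: "0 \<le> c" "c \<le> h 0"
    by blast
  have "\<forall>p q. \<not> (p \<in> {0, 1} \<and> q \<in> {0, 1}) \<longrightarrow> D p q = 0"
    unfolding D using diamond_outside(2) by blast
  moreover have "D 0 0 = c" "D 0 1 = h 0 - c" "D 1 0 = h 0 - c" "D 1 1 = c"
    by (simp_all add: D diamond1_def)
  ultimately show ?L
    unfolding admissible_diamond_def hodge_numbers_1_iff small_intervals
    using h c by simp
qed

text \<open>The bound by \<open>h 1\<close> is monotonicity from \<open>(0,0)\<close> to the centre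
  \<open>h 1 - 2 * b\<close>, and the bound by \<open>h 0\<close> is nonnegativity of
  \<open>D 0 2\<close>. Monotonicity from \<open>(0,1)\<close> and \<open>(1,0)\<close> is an
  equality by symmetry.\<close>

lemma admissible_diamond_2_iff:
  "admissible_diamond 2 h D \<longleftrightarrow>
     h 2 = h 0 \<and>
     (\<exists>a b. 0 \<le> a \<and> 0 \<le> b \<and> a + 2 * b \<le> h 1 \<and> a + b \<le> h 0 \<and> D = diamond2 (h 0) (h 1) a b)"
  (is "?L \<longleftrightarrow> ?R")
proof
  assume ?L
  note L = admissible_diamondD[OF this]
  have h: "h 2 = h 0"
    using L(1) by (simp add: hodge_numbers_2_iff)
  have sym: "D 1 0 = D 0 1" "D 2 0 = D 0 2" "D 2 1 = D 1 2" "D 1 2 = D 0 1" "D 2 2 = D 0 0"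
    using L(5)[of 0 1] L(5)[of 0 2] L(5)[of 1 2] L(6)[of 0 1] L(6)[of 0 0] by simp_all
  have D: "D 0 0 + (D 0 1 + D 0 2) = h 0" "D 0 1 + (D 1 1 + D 0 1) = h 1"
    "0 \<le> D 0 0" "0 \<le> D 0 1" "0 \<le> D 0 2" "D 0 0 \<le> D 1 1"
    using L(4)[of 0] L(4)[of 1] L(3)[of 0 0] L(3)[of 0 1] L(3)[of 0 2] L(7)[of 0 0] sym
    by (simp_all add: small_intervals)
  have "D p q = 0" if "\<not> (p \<in> {0, 1, 2} \<and> q \<in> {0, 1, 2})" for p q
    using L(2) that unfolding small_intervals .
  then have "D p q = diamond2 (h 0) (h 1) (D 0 0) (D 0 1) p q" for p q
  proof (cases "p \<in> {0, 1, 2} \<and> q \<in> {0, 1, 2}")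
    case True
    then show ?thesis
      using D sym by (elim conjE insertE emptyE; hypsubst; simp add: diamond2_def)
  qed (metis diamond_outside(3))
  then have "D = diamond2 (h 0) (h 1) (D 0 0) (D 0 1)"
    by blast
  moreover from D have "D 0 0 + 2 * D 0 1 \<le> h 1" "D 0 0 + D 0 1 \<le> h 0"
    by linarith+
  ultimately show ?R using D(3,4) h by blast
next
  assume ?R
  then obtain a b where h: "h 2 = h 0" and D: "D = diamond2 (h 0) (h 1) a b"
    and ab: "0 \<le> a" "0 \<le> b" "a + 2 * b \<le> h 1" "a + b \<le> h 0"
    by blast
  have "\<forall>p q. \<not> (p \<in> {0, 1, 2} \<and> q \<in> {0, 1, 2}) \<longrightarrow> D p q = 0"
    unfolding D using diamond_outside(3) by blast
  moreover have "D 0 0 = a" "D 0 1 = b" "D 0 2 = h 0 - a - b"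
    "D 1 0 = b" "D 1 1 = h 1 - 2 * b" "D 1 2 = b"
    "D 2 0 = h 0 - a - b" "D 2 1 = b" "D 2 2 = a"
    by (simp_all add: D diamond2_def)
  ultimately show ?L
    unfolding admissible_diamond_def hodge_numbers_2_iff small_intervals
    using h ab by simp
qed

lemma sum_twists_weight_2:
  "(\<Sum>w = 0..2. \<Sum>a = 0..2 - w. twist a (DP w) p q) =
     DP 0 p q + DP 0 (p - 1) (q - 1) + DP 0 (p - 2) (q - 2) +
     DP 1 p q + DP 1 (p - 1) (q - 1) + DP 2 p q"
  by (simp add: small_intervals twist_def)

text \<open>The new parameters are read off at \<open>(0,0)\<close> and \<open>(0,1)\<close>. The
  Hodge numbers are restored because row 0 sums to \<open>a + b + (h0 - a - b)\<close> and row 1 to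
  \<open>a + 2 * b + (h1 - 2 * b - a)\<close>.\<close>

lemma sum_twists_diamonds:
  "diamond0 a p q + diamond0 a (p - 1) (q - 1) + diamond0 a (p - 2) (q - 2) +
     diamond1 b c p q + diamond1 b c (p - 1) (q - 1) +
     diamond2 (h0 - a - b) (h1 - 2 * b - a) x y p q =
   diamond2 h0 h1 (a + c + x) (b - c + y) p q"
proof (cases "p \<in> {0, 1, 2} \<and> q \<in> {0, 1, 2}")
  case True
  then show ?thesis
    by (elim conjE insertE emptyE; hypsubst; simp add: diamond0_def diamond1_def diamond2_def)
next
  case False
  \<comment> \<open>Every twist occurring here is supported inside the 3 by 3 square, so both sides
    vanish off it.\<close>
  have "\<not> (p = 0 \<and> q = 0)" "\<not> (p - 1 = 0 \<and> q - 1 = 0)" "\<not> (p - 2 = 0 \<and> q - 2 = 0)"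
    "\<not> (p \<in> {0, 1} \<and> q \<in> {0, 1})" "\<not> (p - 1 \<in> {0, 1} \<and> q - 1 \<in> {0, 1})"
    using False by auto
  from this(1-3)[THEN diamond_outside(1)] this(4-5)[THEN diamond_outside(2)]
  show ?thesis
    using diamond_outside(3)[OF False] by simp
qed

lemma diamond2_eq_iff:
  "diamond2 h0 h1 a b = diamond2 h0 h1 a' b' \<longleftrightarrow> a = a' \<and> b = b'"
proof
  assume *: "diamond2 h0 h1 a b = diamond2 h0 h1 a' b'"
  from fun_cong[OF fun_cong[OF *, of 0], of 0] fun_cong[OF fun_cong[OF *, of 0], of 1]
  show "a = a' \<and> b = b'" by (simp add: diamond2_def)
qed simp

lemma polarized_le_diamond2_iff:
  assumes "0 \<le> a1" "0 \<le> b1"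
  shows "polarized_le 2 (diamond2 h0 h1 a1 b1) (diamond2 h0 h1 a0 b0) \<longleftrightarrow>
    (\<exists>c x y. 0 \<le> c \<and> c \<le> b1 \<and> 0 \<le> x \<and> 0 \<le> y \<and>
       x + 2 * y \<le> h1 - 2 * b1 - a1 \<and> x + y \<le> h0 - a1 - b1 \<and>
       a0 = a1 + c + x \<and> b0 = b1 - c + y)"
  (is "polarized_le 2 ?D1 ?D0 \<longleftrightarrow> ?R")
proof -
  \<comment> \<open>Only the centre, \<open>D 1 1 - D 0 0\<close>, loses something: in the other
    cases the subtracted entry lies outside the square and is zero.\<close>
  have prim: "primitive ?D1 0 0 = a1" "primitive ?D1 1 0 = b1" "primitive ?D1 1 1 = b1"
    "primitive ?D1 2 0 = h0 - a1 - b1" "primitive ?D1 2 1 = h1 - 2 * b1 - a1"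
    "primitive ?D1 2 2 = h0 - a1 - b1"
    by (simp_all add: primitive_def diamond2_def)
  show ?thesis
  proof
    assume "polarized_le 2 ?D1 ?D0"
    then obtain DP where adm: "\<forall>w\<in>{0, 1, 2}. admissible_diamond w (primitive ?D1 w) (DP w)"
      and D0: "?D0 p q = (\<Sum>w = 0..2. \<Sum>a = 0..2 - w. twist a (DP w) p q)" for p q
      unfolding polarized_le_def small_intervals by blast
    have DP0: "DP 0 = diamond0 a1"
      using adm by (simp add: admissible_diamond_0_iff prim)
    obtain c where c: "0 \<le> c" "c \<le> b1" and DP1: "DP 1 = diamond1 b1 c"
      using adm by (auto simp: admissible_diamond_1_iff prim)
    obtain x y where xy: "0 \<le> x" "0 \<le> y" "x + 2 * y \<le> h1 - 2 * b1 - a1" "x + y \<le> h0 - a1 - b1"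
      and DP2: "DP 2 = diamond2 (h0 - a1 - b1) (h1 - 2 * b1 - a1) x y"
      using adm by (auto simp: admissible_diamond_2_iff prim)
    have "?D0 = diamond2 h0 h1 (a1 + c + x) (b1 - c + y)"
      by (intro ext) (simp only: D0 sum_twists_weight_2 DP0 DP1 DP2 sum_twists_diamonds)
    then show ?R
      using c xy by (auto simp: diamond2_eq_iff)
  next
    assume ?R
    then obtain c x y where c: "0 \<le> c" "c \<le> b1"
      and xy: "0 \<le> x" "0 \<le> y" "x + 2 * y \<le> h1 - 2 * b1 - a1" "x + y \<le> h0 - a1 - b1"
      and ab: "a0 = a1 + c + x" "b0 = b1 - c + y"
      by blast
    \<comment> \<open>Only the weights 0, 1 and 2 occur, so the last branch can also serve as the
      default value.\<close>
    define DP where "DP w = (if w = 0 then diamond0 a1 else if w = 1 then diamond1 b1 c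
      else diamond2 (h0 - a1 - b1) (h1 - 2 * b1 - a1) x y)" for w :: int
    have DP: "DP 0 = diamond0 a1" "DP 1 = diamond1 b1 c"
      "DP 2 = diamond2 (h0 - a1 - b1) (h1 - 2 * b1 - a1) x y"
      by (simp_all add: DP_def)
    have "\<forall>w\<in>{0..2}. admissible_diamond w (primitive ?D1 w) (DP w)"
      using assms c xy
      by (auto simp: small_intervals DP prim admissible_diamond_0_iff admissible_diamond_1_iff
          admissible_diamond_2_iff)
    moreover have "?D0 p q = (\<Sum>w = 0..2. \<Sum>a = 0..2 - w. twist a (DP w) p q)" for p q
      by (simp only: ab sum_twists_weight_2 DP sum_twists_diamonds)
    ultimately show "polarized_le 2 ?D1 ?D0"
      unfolding polarized_le_def by blast
  qed
qed

theorem proposition15: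
  fixes h :: "int \<Rightarrow> int" and D0 D1 :: "int \<Rightarrow> int \<Rightarrow> int"
  assumes "hodge_numbers 2 h"
    and "admissible_diamond 2 h D0"
    and "admissible_diamond 2 h D1"
  shows "polarized_le 2 D1 D0 \<longleftrightarrow>
      D1 0 0 \<le> D0 0 0 \<and>
      D1 0 0 + D1 0 1 \<le> D0 0 0 + D0 0 1 \<and>
      D0 0 0 + D0 0 1 \<le> h 1 - D1 0 1"
proof -
  obtain a0 b0 where D0: "D0 = diamond2 (h 0) (h 1) a0 b0"
    and ab0: "0 \<le> a0" "0 \<le> b0" "a0 + 2 * b0 \<le> h 1" "a0 + b0 \<le> h 0"
    using assms(2) by (auto simp: admissible_diamond_2_iff)
  obtain a1 b1 where D1: "D1 = diamond2 (h 0) (h 1) a1 b1"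
    and ab1: "0 \<le> a1" "0 \<le> b1"
    using assms(3) by (auto simp: admissible_diamond_2_iff)
  have "(\<exists>c x y. 0 \<le> c \<and> c \<le> b1 \<and> 0 \<le> x \<and> 0 \<le> y \<and>
      x + 2 * y \<le> h 1 - 2 * b1 - a1 \<and> x + y \<le> h 0 - a1 - b1 \<and>
      a0 = a1 + c + x \<and> b0 = b1 - c + y) \<longleftrightarrow>
    a1 \<le> a0 \<and> a1 + b1 \<le> a0 + b0 \<and> a0 + b0 \<le> h 1 - b1" (is "?E \<longleftrightarrow> ?I")
  proof
    \<comment> \<open>The first two differences are \<open>c + x\<close> and \<open>x + y\<close>;
      the third inequality follows from \<open>x + y \<le> x + 2 * y\<close>.\<close>
    assume ?E
    then show ?I by auto
  next
    assume ?I
    \<comment> \<open>The least \<open>c\<close> allowed by \<open>0 \<le> c\<close> and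
      \<open>0 \<le> y\<close>. For the value \<open>0\<close>, the bound \<open>a0 - a1\<close> is
      the first inequality and \<open>h 1 - a0 - 2 * b0\<close> is admissibility of
      \<open>D0\<close>; for \<open>b1 - b0\<close> these bounds are the second and third
      inequalities.\<close>
    define c where "c = max 0 (b1 - b0)"
    show ?E
      by (rule exI[of _ c], rule exI[of _ "a0 - a1 - c"], rule exI[of _ "b0 - b1 + c"])
        (use \<open>?I\<close> ab0 ab1 in \<open>auto simp: c_def\<close>)
  qed
  then show ?thesis
    unfolding D0 D1 polarized_le_diamond2_iff[OF ab1] by (simp add: diamond2_def)
qed

end
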